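(* Let $(M^n,g)$, $n\ge3$, be a mixed quasi-Einstein manifold $M(QE)_n$. If $(M,g)$ is conharmonically flat, i.e. the conharmonic curvature tensor satisfies $H(X,Y,Z,W)=0$ for all vector fields $X,Y,Z,W$, then $(M,g)$ is a manifold of mixed quasi-constant curvature $M(QC)_n$.
   Context: Let $(M^n,g)$ be a semi-Riemannian manifold with Riemann curvature $R(X,Y)Z$, $\tilde R(X,Y,Z,W)=g(R(X,Y)Z,W)$ and Ricci tensor $S$. The sign convention is the one in which constant curvature $c$ means $R(X,Y)Z=c[g(Y,Z)X-g(X,Z)Y]$, and $S(Y,Z)=\mathrm{trace}(X\mapsto R(X,Y)Z)$. A non-flat $(M^n,g)$, $n\ge3$, is a mixed quasi-Einstein manifold, denoted $M(QE)_n$, if $S(X,Y)=\alpha g(X,Y)+\beta[A(X)B(Y)+A(Y)B(X)]$ with scalar functions $\alpha,\beta$, $\beta\ne0$, and 1-forms $A(X)=g(X,\xi_1)$, $B(X)=g(X,\xi_2)$, where $g(\xi_1,\xi_1)=1$, $g(\xi_2,\xi_2)=1$, $g(\xi_1,\xi_2)=0$. The conharmonic curvature tensor is $$H(X,Y,Z,W)=\tilde R(X,Y,Z,W)-\tfrac{1}{n-2}[g(X,W)S(Y,Z)-g(X,Z)S(Y,W)+g(Y,Z)S(X,W)-g(Y,W)S(X,Z)].$$ A non-flat $(M,g)$ is a manifold of mixed quasi-constant curvature, denoted $M(QC)_n$, if there are scalar functions $a,b$ and nonzero 1-forms $A,B$ such that, with $E'(X,Y)=A(X)B(Y)+A(Y)B(X)$,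 $$\tilde R(X,Y,Z,W)=a[g(Y,Z)g(X,W)-g(X,Z)g(Y,W)]+b[g(X,W)E'(Y,Z)-g(X,Z)E'(Y,W)+g(Y,Z)E'(X,W)-g(Y,W)E'(X,Z)].$$ *)

theory Defs
  imports "HOL-Analysis.Analysis" "HOL-Library.Function_Algebras"
begin

text \<open>Sums and products of functions and sums of vector fields are the pointwise ones of
  \<^theory>\<open>HOL-Library.Function_Algebras\<close>.\<close>

primrec Ck_on :: "nat \<Rightarrow> 'a::euclidean_space set \<Rightarrow> ('a \<Rightarrow> 'b::real_normed_vector) \<Rightarrow> bool" where
  "Ck_on 0 S f \<longleftrightarrow> continuous_on S f"
| "Ck_on (Suc k) S f \<longleftrightarrow>
     (\<forall>x\<in>S. f differentiable at x) \<and> (\<forall>v. Ck_on k S (\<lambda>x. frechet_derivative f (at x) v))"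

text \<open>Only meant for open \<open>S\<close>.\<close>

definition smooth_on :: "'a::euclidean_space set \<Rightarrow> ('a \<Rightarrow> 'b::real_normed_vector) \<Rightarrow> bool" where
  "smooth_on S f \<longleftrightarrow> (\<forall>k. Ck_on k S f)"

type_synonym ('m, 'n) chart = "'m set \<times> ('m \<Rightarrow> real^'n)"
type_synonym 'm scalar = "'m \<Rightarrow> real"
type_synonym 'm vfield = "'m scalar \<Rightarrow> 'm scalar"

definition is_chart :: "('m::topological_space, 'n::finite) chart \<Rightarrow> bool" where
  "is_chart = (\<lambda>(U, \<phi>). open U \<and> open (\<phi> ` U) \<and> homeomorphism U (\<phi> ` U) \<phi> (inv_into U \<phi>))"

definition fun_scale :: "'m scalar \<Rightarrow> 'm vfield \<Rightarrow> 'm vfield" (infixr "\<odot>" 75) where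
  "h \<odot> X = (\<lambda>f. h * X f)"

definition lie_bracket :: "'m vfield \<Rightarrow> 'm vfield \<Rightarrow> 'm vfield" where
  "lie_bracket X Y = (\<lambda>f. X (Y f) - Y (X f))"

text \<open>The manifold is the whole type \<open>'m\<close>; its dimension is \<open>CARD('n)\<close>. The atlas need not be
  maximal.\<close>

locale smooth_manifold =
  fixes atlas :: "('m::{t2_space, second_countable_topology}, 'n::finite) chart set"
  assumes charts: "c \<in> atlas \<Longrightarrow> is_chart c"
    and cover: "(\<Union>(U, \<phi>)\<in>atlas. U) = UNIV"
    and compatible: "(U, \<phi>) \<in> atlas \<Longrightarrow> (V, \<psi>) \<in> atlas \<Longrightarrow>
      smooth_on (\<phi> ` (U \<inter> V)) (\<psi> \<circ> inv_into U \<phi>)"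
begin

definition smooth_functions :: "'m scalar set" ("\<FF>") where
  "\<FF> = {f. \<forall>(U, \<phi>)\<in>atlas. smooth_on (\<phi> ` U) (f \<circ> inv_into U \<phi>)}"

text \<open>Vector fields are the derivations of the algebra of smooth functions. HOL functions being
  total, a vector field is required to vanish on non-smooth arguments, so that equality of vector
  fields is equality on smooth functions.\<close>

definition vector_fields :: "'m vfield set" ("\<XX>") where
  "\<XX> = {X. (\<forall>f\<in>\<FF>. X f \<in> \<FF>) \<and>
    (\<forall>f\<in>\<FF>. \<forall>h\<in>\<FF>. X (f + h) = X f + X h) \<and>
    (\<forall>c. \<forall>f\<in>\<FF>. X ((\<lambda>_. c) * f) = (\<lambda>_. c) * X f) \<and>
    (\<forall>f\<in>\<FF>. \<forall>h\<in>\<FF>. X (f * h) = X f * h + f * X h) \<and>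
    (\<forall>f. f \<notin> \<FF> \<longrightarrow> X f = 0)}"

definition one_forms :: "('m vfield \<Rightarrow> 'm scalar) set" where
  "one_forms = {A. (\<forall>X\<in>\<XX>. A X \<in> \<FF>) \<and>
    (\<forall>X\<in>\<XX>. \<forall>Y\<in>\<XX>. A (X + Y) = A X + A Y) \<and>
    (\<forall>h\<in>\<FF>. \<forall>X\<in>\<XX>. A (h \<odot> X) = h * A X)}"

definition nonzero_form :: "('m vfield \<Rightarrow> 'm scalar) \<Rightarrow> bool" where
  "nonzero_form A \<longleftrightarrow> (\<exists>X\<in>\<XX>. A X \<noteq> 0)"

text \<open>Every tangent vector at \<open>p\<close> is the value \<open>\<lambda>f. X f p\<close> of some global vector field, so bases
  of the tangent space at \<open>p\<close> are described by vector fields whose values at \<open>p\<close> form a basis.\<close>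

definition basis_at :: "'m \<Rightarrow> ('n \<Rightarrow> 'm vfield) \<Rightarrow> bool" where
  "basis_at p E \<longleftrightarrow> (\<forall>i. E i \<in> \<XX>) \<and>
    (\<forall>X\<in>\<XX>. \<exists>!c::'n \<Rightarrow> real. \<forall>f\<in>\<FF>. X f p = (\<Sum>i\<in>UNIV. c i * E i f p))"

definition coords_at :: "'m \<Rightarrow> ('n \<Rightarrow> 'm vfield) \<Rightarrow> 'm vfield \<Rightarrow> 'n \<Rightarrow> real" where
  "coords_at p E X = (THE c. \<forall>f\<in>\<FF>. X f p = (\<Sum>i\<in>UNIV. c i * E i f p))"

text \<open>Trace of the endomorphism of the tangent space at \<open>p\<close> induced by an \<open>\<FF>\<close>-linear map \<open>L\<close>
  of vector fields; it does not depend on the basis.\<close>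

definition trace_at :: "('m vfield \<Rightarrow> 'm vfield) \<Rightarrow> 'm \<Rightarrow> real" where
  "trace_at L p =
    (THE t. \<forall>E. basis_at p E \<longrightarrow> t = (\<Sum>i\<in>UNIV. coords_at p E (L (E i)) i))"

text \<open>Largest dimension of a subspace of the tangent space at \<open>p\<close> on which \<open>g\<close> is negative
  definite.\<close>

definition index_at :: "('m vfield \<Rightarrow> 'm vfield \<Rightarrow> 'm scalar) \<Rightarrow> 'm \<Rightarrow> nat" where
  "index_at g p = Max {k. \<exists>E::nat \<Rightarrow> 'm vfield. (\<forall>i<k. E i \<in> \<XX>) \<and>
    (\<forall>c::nat \<Rightarrow> real. (\<exists>i<k. c i \<noteq> 0) \<longrightarrow>
      (\<Sum>i<k. \<Sum>j<k. c i * c j * g (E i) (E j) p) < 0)}"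

end

locale semi_riemannian_manifold = smooth_manifold atlas
  for atlas :: "('m::{t2_space, second_countable_topology}, 'n::finite) chart set" +
  fixes g :: "'m vfield \<Rightarrow> 'm vfield \<Rightarrow> 'm scalar"
  assumes g_smooth: "X \<in> \<XX> \<Longrightarrow> Y \<in> \<XX> \<Longrightarrow> g X Y \<in> \<FF>"
    and g_sym: "X \<in> \<XX> \<Longrightarrow> Y \<in> \<XX> \<Longrightarrow> g X Y = g Y X"
    and g_add: "X \<in> \<XX> \<Longrightarrow> Y \<in> \<XX> \<Longrightarrow> Z \<in> \<XX> \<Longrightarrow> g (X + Y) Z = g X Z + g Y Z"
    and g_scale: "h \<in> \<FF> \<Longrightarrow> X \<in> \<XX> \<Longrightarrow> Y \<in> \<XX> \<Longrightarrow> g (h \<odot> X) Y = h * g X Y"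
    and g_nondegenerate: "X \<in> \<XX> \<Longrightarrow> (\<And>Y. Y \<in> \<XX> \<Longrightarrow> g X Y p = 0) \<Longrightarrow> X f p = 0"
    and g_index: "\<exists>\<nu>. \<forall>p. index_at g p = \<nu>"
begin

definition is_levi_civita :: "('m vfield \<Rightarrow> 'm vfield \<Rightarrow> 'm vfield) \<Rightarrow> bool" where
  "is_levi_civita D \<longleftrightarrow>
    (\<forall>X\<in>\<XX>. \<forall>Y\<in>\<XX>. D X Y \<in> \<XX>) \<and>
    (\<forall>X\<in>\<XX>. \<forall>Y\<in>\<XX>. \<forall>Z\<in>\<XX>. D (X + Y) Z = D X Z + D Y Z) \<and>
    (\<forall>h\<in>\<FF>. \<forall>X\<in>\<XX>. \<forall>Y\<in>\<XX>. D (h \<odot> X) Y = h \<odot> D X Y) \<and>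
    (\<forall>X\<in>\<XX>. \<forall>Y\<in>\<XX>. \<forall>Z\<in>\<XX>. D X (Y + Z) = D X Y + D X Z) \<and>
    (\<forall>h\<in>\<FF>. \<forall>X\<in>\<XX>. \<forall>Y\<in>\<XX>. D X (h \<odot> Y) = X h \<odot> Y + h \<odot> D X Y) \<and>
    (\<forall>X\<in>\<XX>. \<forall>Y\<in>\<XX>. D X Y - D Y X = lie_bracket X Y) \<and>
    (\<forall>X\<in>\<XX>. \<forall>Y\<in>\<XX>. \<forall>Z\<in>\<XX>. X (g Y Z) = g (D X Y) Z + g Y (D X Z))"

text \<open>Unique on \<open>\<XX>\<close>, by the Koszul formula.\<close>

definition nabla :: "'m vfield \<Rightarrow> 'm vfield \<Rightarrow> 'm vfield" ("\<nabla>") where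
  "\<nabla> = (SOME D. is_levi_civita D)"

definition riemann :: "'m vfield \<Rightarrow> 'm vfield \<Rightarrow> 'm vfield \<Rightarrow> 'm vfield" where
  "riemann X Y Z = \<nabla> X (\<nabla> Y Z) - \<nabla> Y (\<nabla> X Z) - \<nabla> (lie_bracket X Y) Z"

definition riemann4 :: "'m vfield \<Rightarrow> 'm vfield \<Rightarrow> 'm vfield \<Rightarrow> 'm vfield \<Rightarrow> 'm scalar" where
  "riemann4 X Y Z W = g (riemann X Y Z) W"

definition ricci :: "'m vfield \<Rightarrow> 'm vfield \<Rightarrow> 'm scalar" where
  "ricci Y Z = (\<lambda>p. trace_at (\<lambda>X. riemann X Y Z) p)"

definition non_flat :: bool where
  "non_flat \<longleftrightarrow> (\<exists>X\<in>\<XX>. \<exists>Y\<in>\<XX>. \<exists>Z\<in>\<XX>. riemann X Y Z \<noteq> 0)"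

definition conharmonic :: "'m vfield \<Rightarrow> 'm vfield \<Rightarrow> 'm vfield \<Rightarrow> 'm vfield \<Rightarrow> 'm scalar" where
  "conharmonic X Y Z W = (\<lambda>p. riemann4 X Y Z W p - 1 / (real CARD('n) - 2) *
    (g X W p * ricci Y Z p - g X Z p * ricci Y W p
      + g Y Z p * ricci X W p - g Y W p * ricci X Z p))"

definition conharmonically_flat :: bool where
  "conharmonically_flat \<longleftrightarrow> (\<forall>X\<in>\<XX>. \<forall>Y\<in>\<XX>. \<forall>Z\<in>\<XX>. \<forall>W\<in>\<XX>. conharmonic X Y Z W = 0)"

definition mixed_quasi_einstein :: bool where
  "mixed_quasi_einstein \<longleftrightarrow> CARD('n) \<ge> 3 \<and> non_flat \<and>
    (\<exists>\<alpha>\<in>\<FF>. \<exists>\<beta>\<in>\<FF>. \<exists>\<xi>\<^sub>1\<in>\<XX>. \<exists>\<xi>\<^sub>2\<in>\<XX>. \<exists>A B.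
      \<beta> \<noteq> 0 \<and> A = (\<lambda>X. g X \<xi>\<^sub>1) \<and> B = (\<lambda>X. g X \<xi>\<^sub>2) \<and>
      g \<xi>\<^sub>1 \<xi>\<^sub>1 = 1 \<and> g \<xi>\<^sub>2 \<xi>\<^sub>2 = 1 \<and> g \<xi>\<^sub>1 \<xi>\<^sub>2 = 0 \<and>
      (\<forall>X\<in>\<XX>. \<forall>Y\<in>\<XX>. ricci X Y = \<alpha> * g X Y + \<beta> * (A X * B Y + A Y * B X)))"

definition mixed_quasi_constant_curvature :: bool where
  "mixed_quasi_constant_curvature \<longleftrightarrow> non_flat \<and>
    (\<exists>a\<in>\<FF>. \<exists>b\<in>\<FF>. \<exists>A\<in>one_forms. \<exists>B\<in>one_forms. \<exists>E'.
      nonzero_form A \<and> nonzero_form B \<and>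
      E' = (\<lambda>X Y. A X * B Y + A Y * B X) \<and>
      (\<forall>X\<in>\<XX>. \<forall>Y\<in>\<XX>. \<forall>Z\<in>\<XX>. \<forall>W\<in>\<XX>. riemann4 X Y Z W =
        a * (g Y Z * g X W - g X Z * g Y W) +
        b * (g X W * E' Y Z - g X Z * E' Y W + g Y Z * E' X W - g Y W * E' X Z)))"

end

end

theory Submission
  imports Defs
begin

text \<open>Substituting the mixed quasi-Einstein form of the Ricci tensor into \<open>H = 0\<close> gives the
  curvature directly: the two \<open>\<alpha>\<close>-contributions to each term of the constant-curvature part
  coincide, whence \<open>a = 2\<alpha> / (n - 2)\<close> and \<open>b = \<beta> / (n - 2)\<close>, with the same 1-forms.\<close>

text \<open>\<open>frechet_derivative\<close> at a point depends only on the values near that point.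
  Since \<open>S\<close> is open, agreement on \<open>S\<close> therefore passes to the derivatives
  on \<open>S\<close>, and from there to every order.\<close>

lemma Ck_on_cong:
  fixes f h :: "'a::euclidean_space \<Rightarrow> 'b::real_normed_vector"
  assumes "open S" "\<And>x. x \<in> S \<Longrightarrow> f x = h x" "Ck_on k S f"
  shows "Ck_on k S h"
  using assms(2,3)
proof (induction k arbitrary: f h)
  case 0
  then show ?case
    by (metis Ck_on.simps(1) continuous_on_cong)
next
  case (Suc k)
  have fr: "frechet_derivative f (at x) = frechet_derivative h (at x)" if "x \<in> S" for x
    using Suc.prems that assms(1) by (intro frechet_derivative_transform_within_open) auto
  have "h differentiable at x" if "x \<in> S" for x
  proof -
    obtain f' where "(f has_derivative f') (at x)"
      using Suc.prems(2) \<open>x \<in> S\<close> unfolding Ck_on.simps differentiable_def by blast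
    then have "(h has_derivative f') (at x)"
      using has_derivative_transform_within_open assms(1) that Suc.prems(1) by blast
    then show ?thesis
      by (auto simp: differentiable_def)
  qed
  moreover have "Ck_on k S (\<lambda>x. frechet_derivative h (at x) v)" for v
    \<comment> \<open>The induction runs with \<open>f\<close> and \<open>h\<close> arbitrary
      because its hypothesis is applied here to their directional derivatives.\<close>
    by (rule Suc.IH[of "\<lambda>x. frechet_derivative f (at x) v"]) (use Suc.prems(2) fr in auto)
  ultimately show ?case
    by simp
qed

lemma Ck_on_cmult:
  fixes f :: "'a::euclidean_space \<Rightarrow> real"
  assumes "open S" "Ck_on k S f"
  shows "Ck_on k S (\<lambda>x. c * f x)"
  using assms(2)
proof (induction k arbitrary: f)
  case 0
  then show ?case
    by (auto intro: continuous_intros)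
next
  case (Suc k)
  have der: "((\<lambda>y. c * f y) has_derivative (\<lambda>v. c * frechet_derivative f (at x) v)) (at x)"
    if "x \<in> S" for x
    using Suc.prems that by (auto intro!: has_derivative_mult_right simp: frechet_derivative_works)
  have "Ck_on k S (\<lambda>x. frechet_derivative (\<lambda>y. c * f y) (at x) v)" for v
  \<comment> \<open>Off \<open>S\<close> the function \<open>f\<close> may fail to be
    differentiable, so the derivative of the multiple is known to be the multiple of the derivative
    on \<open>S\<close> only. Congruence on \<open>S\<close> replaces rewriting.\<close>
  proof (rule Ck_on_cong[OF assms(1)])
    show "Ck_on k S (\<lambda>x. c * frechet_derivative f (at x) v)"
      using Suc by auto
    show "c * frechet_derivative f (at x) v = frechet_derivative (\<lambda>y. c * f y) (at x) v"
      if "x \<in> S" for x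
      using frechet_derivative_at[OF der[OF that]] by metis
  qed
  then show ?case
    using der by (auto simp: differentiable_def)
qed

text \<open>Serves to show that the curvature scalars, constant multiples of \<alpha> and \<beta>,
  are smooth.\<close>

lemma (in smooth_manifold) smooth_functions_cmult:
  assumes "f \<in> \<FF>"
  shows "(\<lambda>p. c * f p) \<in> \<FF>"
  unfolding smooth_functions_def
proof (clarify)
  fix U \<phi>
  assume U: "(U, \<phi>) \<in> atlas"
  then have "open (\<phi> ` U)"
    using charts by (auto simp: is_chart_def)
  moreover have "smooth_on (\<phi> ` U) (f \<circ> inv_into U \<phi>)"
    using assms U by (auto simp: smooth_functions_def)
  ultimately show "smooth_on (\<phi> ` U) ((\<lambda>p. c * f p) \<circ> inv_into U \<phi>)"
    by (simp add: smooth_on_def o_def Ck_on_cmult)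
qed

context semi_riemannian_manifold
begin

lemma metric_dual_one_form:
  assumes "\<xi> \<in> \<XX>"
  shows "(\<lambda>X. g X \<xi>) \<in> one_forms"
  using assms by (auto simp: one_forms_def g_smooth g_add g_scale)

text \<open>The form takes the value 1 on \<xi> itself.\<close>

lemma unit_metric_dual_nonzero:
  assumes "\<xi> \<in> \<XX>" "g \<xi> \<xi> = 1"
  shows "nonzero_form (\<lambda>X. g X \<xi>)"
  unfolding nonzero_form_def
proof
  show "g \<xi> \<xi> \<noteq> 0"
    using assms(2) by (simp add: fun_eq_iff)
qed fact

lemma conharmonically_flat_imp_mixed_quasi_constant:
  assumes "mixed_quasi_einstein" "conharmonically_flat"
  shows "mixed_quasi_constant_curvature"
proof -
  obtain \<alpha> \<beta> \<xi> \<eta> where sm: "\<alpha> \<in> \<FF>" "\<beta> \<in> \<FF>" and xi: "\<xi> \<in> \<XX>" "\<eta> \<in> \<XX>"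
    and unit: "g \<xi> \<xi> = 1" "g \<eta> \<eta> = 1"
    and ric: "\<And>X Y. X \<in> \<XX> \<Longrightarrow> Y \<in> \<XX> \<Longrightarrow>
      ricci X Y = \<alpha> * g X Y + \<beta> * (g X \<xi> * g Y \<eta> + g Y \<xi> * g X \<eta>)"
    using assms(1) unfolding mixed_quasi_einstein_def by blast
  have nf: "non_flat"
    using assms(1) unfolding mixed_quasi_einstein_def by blast
  define c where "c = 1 / (real CARD('n) - 2)"
  define a b where "a = (\<lambda>p. (2 * c) * \<alpha> p)" and "b = (\<lambda>p. c * \<beta> p)"
  define E' where "E' = (\<lambda>X Y. g X \<xi> * g Y \<eta> + g Y \<xi> * g X \<eta>)"
  have "riemann4 X Y Z W = a * (g Y Z * g X W - g X Z * g Y W) +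
      b * (g X W * E' Y Z - g X Z * E' Y W + g Y Z * E' X W - g Y W * E' X Z)"
    if V: "X \<in> \<XX>" "Y \<in> \<XX>" "Z \<in> \<XX>" "W \<in> \<XX>" for X Y Z W
  proof
    fix p
    have "conharmonic X Y Z W p = 0"
      using assms(2) V unfolding conharmonically_flat_def by simp
    then have "riemann4 X Y Z W p = c * (g X W p * ricci Y Z p - g X Z p * ricci Y W p
        + g Y Z p * ricci X W p - g Y W p * ricci X Z p)"
      by (simp add: conharmonic_def c_def)
    then show "riemann4 X Y Z W p = (a * (g Y Z * g X W - g X Z * g Y W) +
        b * (g X W * E' Y Z - g X Z * E' Y W + g Y Z * E' X W - g Y W * E' X Z)) p"
      \<comment> \<open>The terms with \<open>ricci Y Z\<close> and \<open>ricci X W\<close> both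
        contribute \<open>\<alpha> * g Y Z * g X W\<close>; the other two both contribute
        \<open>- \<alpha> * g X Z * g Y W\<close>. The \<beta> parts are the four \<open>E'\<close>
        terms in the same order.\<close>
      by (simp add: ric V a_def b_def E'_def algebra_simps)
  qed
  moreover have "a \<in> \<FF>" "b \<in> \<FF>"
    unfolding a_def b_def using sm smooth_functions_cmult by blast+
  ultimately show ?thesis
    unfolding mixed_quasi_constant_curvature_def
    using nf E'_def metric_dual_one_form[OF xi(1)] metric_dual_one_form[OF xi(2)]
      unit_metric_dual_nonzero[OF xi(1) unit(1)] unit_metric_dual_nonzero[OF xi(2) unit(2)]
    by blast
qed

end

theorem theorem3p4:
  fixes atlas :: "('m::{t2_space, second_countable_topology}, 'n::finite) chart set"
    and g :: "'m vfield \<Rightarrow> 'm vfield \<Rightarrow> 'm scalar"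
  assumes "semi_riemannian_manifold atlas g"
    and "CARD('n) \<ge> 3"
    and "semi_riemannian_manifold.mixed_quasi_einstein atlas g"
    and "semi_riemannian_manifold.conharmonically_flat atlas g"
  shows "semi_riemannian_manifold.mixed_quasi_constant_curvature atlas g"
  using semi_riemannian_manifold.conharmonically_flat_imp_mixed_quasi_constant assms(1,3,4) .

end
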